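(* For every $n\ge1$, the number $M(n)$ of distinct self-dual linear Kleinian codes of length $n$ satisfies $$M(n)=\prod_{i=1}^{n}(2^i+1)=\sum_{C}\frac{6^n\cdot n!}{|\mathrm{Aut}(C)|},$$ where the sum runs over the equivalence classes of self-dual codes of length $n$. For every even $n\ge 2$, the number $M_e(n)$ of distinct even self-dual linear Kleinian codes of length $n$ satisfies $$M_e(n)=\prod_{i=0}^{n-1}(2^i+1)=\sum_{C}\frac{6^n\cdot n!}{|\mathrm{Aut}(C)|},$$ where the sum runs over the equivalence classes of even self-dual codes of length $n$.
   Context: Let $K=\{0,a,b,c\}$ be the Kleinian four-group. A linear code of length $n$ is a subgroup of $K^n$; $\mathrm{wt}(\mathbf{x})$ is the number of nonzero coordinates. Define $x\cdot y\in\mathbb{F}_2$ for $x,y\in K$ by $x\cdot y=1$ iff $x,y$ are nonzero and distinct; $(\mathbf{x},\mathbf{y})=\sum_ix_i\cdot y_i$; $C^\perp=\{\mathbf{x}:(\mathbf{x},\mathbf{y})=0\ \forall \mathbf{y}\in C\}$; $C$ is self-dual if $C=C^\perp$ and even if all its codewords have even weight. The group $G=S_3^n\rtimes S_n$ (of order $6^n n!$) acts on $K^n$ by permuting coordinates and independently permuting $a,b,c$ in each coordinate; $C,D$ are equivalent if $gC=D$ for some $g\in G$, and $\mathrm{Aut}(C)=\{g\in G:gC=C\}$. *)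

theory Defs
  imports "HOL-Algebra.Algebra" "HOL-Library.Z2"
begin

section \<open>The Kleinian four-group and its words\<close>

datatype klein = K0 | Ka | Kb | Kc

fun klein_add :: "klein \<Rightarrow> klein \<Rightarrow> klein" where
  "klein_add K0 y = y"
| "klein_add x K0 = x"
| "klein_add Ka Kb = Kc"
| "klein_add Kb Ka = Kc"
| "klein_add Ka Kc = Kb"
| "klein_add Kc Ka = Kb"
| "klein_add Kb Kc = Ka"
| "klein_add Kc Kb = Ka"
| "klein_add x y = K0"

definition klein_group :: "klein monoid" where
  "klein_group = \<lparr>carrier = UNIV, monoid.mult = klein_add, one = K0\<rparr>"

text \<open>Coordinates are indexed by \<open>{1..n}\<close>, the set on which \<^const>\<open>sym_group\<close> acts; a word is
  a function on \<^typ>\<open>nat\<close> that is \<^const>\<open>undefined\<close> outside this set.\<close>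

type_synonym word = "nat \<Rightarrow> klein"

definition klein_power :: "nat \<Rightarrow> word monoid" where
  "klein_power n = product_group {1..n} (\<lambda>_. klein_group)"

definition wt :: "nat \<Rightarrow> word \<Rightarrow> nat" where
  "wt n x = card {i \<in> {1..n}. x i \<noteq> K0}"

definition klein_dot :: "klein \<Rightarrow> klein \<Rightarrow> bit" where
  "klein_dot x y = (if x \<noteq> K0 \<and> y \<noteq> K0 \<and> x \<noteq> y then 1 else 0)"

definition word_form :: "nat \<Rightarrow> word \<Rightarrow> word \<Rightarrow> bit" where
  "word_form n x y = (\<Sum>i=1..n. klein_dot (x i) (y i))"

section \<open>Codes\<close>

definition linear_code :: "nat \<Rightarrow> word set \<Rightarrow> bool" where
  "linear_code n C \<longleftrightarrow> subgroup C (klein_power n)"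

definition dual_code :: "nat \<Rightarrow> word set \<Rightarrow> word set" where
  "dual_code n C = {x \<in> carrier (klein_power n). \<forall>y\<in>C. word_form n x y = 0}"

definition self_dual :: "nat \<Rightarrow> word set \<Rightarrow> bool" where
  "self_dual n C \<longleftrightarrow> C = dual_code n C"

definition even_code :: "nat \<Rightarrow> word set \<Rightarrow> bool" where
  "even_code n C \<longleftrightarrow> (\<forall>x\<in>C. even (wt n x))"

definition self_dual_codes :: "nat \<Rightarrow> word set set" where
  "self_dual_codes n = {C. linear_code n C \<and> self_dual n C}"

definition even_self_dual_codes :: "nat \<Rightarrow> word set set" where
  "even_self_dual_codes n = {C. linear_code n C \<and> self_dual n C \<and> even_code n C}"

section \<open>The symmetry group, equivalence and automorphisms\<close>

definition letter_group :: "(klein \<Rightarrow> klein) monoid" where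
  "letter_group = \<lparr>carrier = {s. s permutes {Ka, Kb, Kc}}, monoid.mult = (\<circ>), one = id\<rparr>"

text \<open>The pair \<open>(s, p)\<close> moves the entry in coordinate \<open>i\<close> to coordinate \<open>p i\<close> and then applies
  \<open>s j\<close> to the entry in each coordinate \<open>j\<close>; the multiplication is the one that makes this a left
  action.\<close>

definition code_group :: "nat \<Rightarrow> ((nat \<Rightarrow> klein \<Rightarrow> klein) \<times> (nat \<Rightarrow> nat)) monoid" where
  "code_group n =
     \<lparr>carrier = carrier (product_group {1..n} (\<lambda>_. letter_group)) \<times> carrier (sym_group n),
      monoid.mult = (\<lambda>(s, p) (t, q).
        (s \<otimes>\<^bsub>product_group {1..n} (\<lambda>_. letter_group)\<^esub> (\<lambda>i\<in>{1..n}. t (inv_into UNIV p i)),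
         p \<otimes>\<^bsub>sym_group n\<^esub> q)),
      one = (\<one>\<^bsub>product_group {1..n} (\<lambda>_. letter_group)\<^esub>, \<one>\<^bsub>sym_group n\<^esub>)\<rparr>"

definition word_act :: "nat \<Rightarrow> (nat \<Rightarrow> klein \<Rightarrow> klein) \<times> (nat \<Rightarrow> nat) \<Rightarrow> word \<Rightarrow> word" where
  "word_act n = (\<lambda>(s, p) x. \<lambda>i\<in>{1..n}. s i (x (inv_into UNIV p i)))"

definition code_act ::
  "nat \<Rightarrow> (nat \<Rightarrow> klein \<Rightarrow> klein) \<times> (nat \<Rightarrow> nat) \<Rightarrow> word set \<Rightarrow> word set" where
  "code_act n g C = word_act n g ` C"

definition code_equiv :: "nat \<Rightarrow> (word set \<times> word set) set" where
  "code_equiv n = {(C, D). linear_code n C \<and> linear_code n D \<and>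
     (\<exists>g\<in>carrier (code_group n). code_act n g C = D)}"

definition code_Aut ::
  "nat \<Rightarrow> word set \<Rightarrow> ((nat \<Rightarrow> klein \<Rightarrow> klein) \<times> (nat \<Rightarrow> nat)) set" where
  "code_Aut n C = stabilizer (code_group n) (code_act n) C"

section \<open>Basic facts\<close>

lemma klein_add_assoc: "klein_add (klein_add x y) z = klein_add x (klein_add y z)"
  by (cases x; cases y; cases z) simp_all

lemma klein_add_self: "klein_add x x = K0"
  by (cases x) simp_all

lemma comm_group_klein: "comm_group klein_group"
proof (rule comm_groupI)
  fix x y :: klein
  show "x \<otimes>\<^bsub>klein_group\<^esub> y = y \<otimes>\<^bsub>klein_group\<^esub> x"
    by (cases x; cases y) (simp_all add: klein_group_def)
qed (auto simp: klein_group_def klein_add_assoc intro: klein_add_self)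

lemma klein_dot_add: "klein_dot (klein_add x y) z = klein_dot x z + klein_dot y z"
  by (cases x; cases y; cases z) (simp_all add: klein_dot_def)

lemma group_klein_power: "group (klein_power n)"
  unfolding klein_power_def using comm_group_klein comm_group.axioms(2) by (intro product_group) blast

lemma group_letter: "group letter_group"
proof (rule groupI)
  fix s assume "s \<in> carrier letter_group"
  then show "\<exists>t\<in>carrier letter_group. t \<otimes>\<^bsub>letter_group\<^esub> s = \<one>\<^bsub>letter_group\<^esub>"
    by (auto simp: letter_group_def intro!: bexI[of _ "inv_into UNIV s"] permutes_inv permutes_inv_o)
qed (auto simp: letter_group_def permutes_compose permutes_id o_assoc)

lemma code_group_mult:
  "(s, p) \<otimes>\<^bsub>code_group n\<^esub> (t, q) = (\<lambda>i\<in>{1..n}. s i \<circ> t (inv_into UNIV p i), p \<circ> q)"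
  by (auto simp: code_group_def letter_group_def sym_group_def fun_eq_iff)

lemma code_group_one: "\<one>\<^bsub>code_group n\<^esub> = (\<lambda>i\<in>{1..n}. id, id)"
  by (simp add: code_group_def letter_group_def sym_group_def)

lemma code_group_carrier:
  "(s, p) \<in> carrier (code_group n) \<longleftrightarrow>
     s \<in> {1..n} \<rightarrow>\<^sub>E {s. s permutes {Ka, Kb, Kc}} \<and> p permutes {1..n}"
  by (simp add: code_group_def letter_group_def sym_group_def)

lemma group_code_group: "group (code_group n)"
proof (rule groupI)
  fix g h assume "g \<in> carrier (code_group n)" "h \<in> carrier (code_group n)"
  then obtain s p t q where g: "g = (s, p)" "h = (t, q)"
    and *: "s \<in> {1..n} \<rightarrow>\<^sub>E {s. s permutes {Ka, Kb, Kc}}" "p permutes {1..n}"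
      "t \<in> {1..n} \<rightarrow>\<^sub>E {s. s permutes {Ka, Kb, Kc}}" "q permutes {1..n}"
    by (metis code_group_carrier surj_pair)
  have "inv_into UNIV p i \<in> {1..n}" if "i \<in> {1..n}" for i
    using permutes_in_image[OF permutes_inv[OF *(2)]] that by blast
  then show "g \<otimes>\<^bsub>code_group n\<^esub> h \<in> carrier (code_group n)"
    using * unfolding g code_group_mult code_group_carrier
    by (auto intro!: permutes_compose simp: PiE_iff)
next
  show "\<one>\<^bsub>code_group n\<^esub> \<in> carrier (code_group n)"
    unfolding code_group_one code_group_carrier by (auto simp: permutes_id)
next
  fix g h k
  assume "g \<in> carrier (code_group n)" "h \<in> carrier (code_group n)" "k \<in> carrier (code_group n)"
  then obtain s p t q u r where g: "g = (s, p)" "h = (t, q)" "k = (u, r)"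
    and *: "p permutes {1..n}" "q permutes {1..n}"
    by (metis code_group_carrier surj_pair)
  have "inv_into UNIV p i \<in> {1..n}" if "i \<in> {1..n}" for i
    using permutes_in_image[OF permutes_inv[OF *(1)]] that by blast
  moreover have "inv_into UNIV (p \<circ> q) = inv_into UNIV q \<circ> inv_into UNIV p"
    using * by (intro o_inv_distrib permutes_bij)
  ultimately show "g \<otimes>\<^bsub>code_group n\<^esub> h \<otimes>\<^bsub>code_group n\<^esub> k = g \<otimes>\<^bsub>code_group n\<^esub> (h \<otimes>\<^bsub>code_group n\<^esub> k)"
    unfolding g code_group_mult by (auto simp: fun_eq_iff)
next
  fix g assume "g \<in> carrier (code_group n)"
  then obtain s p where g: "g = (s, p)"
    and *: "s \<in> {1..n} \<rightarrow>\<^sub>E {s. s permutes {Ka, Kb, Kc}}" "p permutes {1..n}"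
    by (metis code_group_carrier surj_pair)
  show "\<one>\<^bsub>code_group n\<^esub> \<otimes>\<^bsub>code_group n\<^esub> g = g"
    using * unfolding g code_group_one code_group_mult by (auto simp: fun_eq_iff PiE_iff extensional_def)
  define h where "h = (\<lambda>i\<in>{1..n}. inv_into UNIV (s (p i)), inv_into UNIV p)"
  have im: "p i \<in> {1..n}" if "i \<in> {1..n}" for i
    using permutes_in_image[OF *(2)] that by blast
  have sp: "s (p i) permutes {Ka, Kb, Kc}" if "i \<in> {1..n}" for i
    using *(1) im[OF that] by (auto simp: PiE_iff)
  have "h \<in> carrier (code_group n)"
    unfolding h_def code_group_carrier using sp * by (auto simp del: One_nat_def intro: permutes_inv)
  moreover have "h \<otimes>\<^bsub>code_group n\<^esub> g = \<one>\<^bsub>code_group n\<^esub>"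
    unfolding h_def g code_group_mult code_group_one
    using permutes_inverses(2)[OF sp] permutes_inverses(2)[OF *(2)] permutes_inv_inv[OF *(2)]
    by (auto simp: fun_eq_iff)
  ultimately show "\<exists>h\<in>carrier (code_group n). h \<otimes>\<^bsub>code_group n\<^esub> g = \<one>\<^bsub>code_group n\<^esub>" by blast
qed

lemma order_code_group: "order (code_group n) = 6 ^ n * fact n"
proof -
  have "card {s. s permutes {Ka, Kb, Kc}} = fact 3"
    by (rule card_permutations) auto
  moreover have "card {p. p permutes {1..n}} = fact n"
    by (rule card_permutations) auto
  ultimately show ?thesis
    by (simp add: order_def code_group_def letter_group_def sym_group_def card_PiE
        card_cartesian_product fact_numeral)
qed

lemma word_act_one:
  assumes "x \<in> carrier (klein_power n)"
  shows "word_act n \<one>\<^bsub>code_group n\<^esub> x = x"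
  using assms
  by (auto simp: word_act_def code_group_one klein_power_def fun_eq_iff PiE_iff extensional_def)

lemma word_act_mult:
  assumes "g \<in> carrier (code_group n)" "h \<in> carrier (code_group n)"
  shows "word_act n (g \<otimes>\<^bsub>code_group n\<^esub> h) x = word_act n g (word_act n h x)"
proof -
  obtain s p t q where g: "g = (s, p)" "h = (t, q)"
    and *: "p permutes {1..n}" "q permutes {1..n}"
    using assms by (metis code_group_carrier surj_pair)
  have "inv_into UNIV p i \<in> {1..n}" if "i \<in> {1..n}" for i
    using permutes_in_image[OF permutes_inv[OF *(1)]] that by blast
  moreover have "inv_into UNIV (p \<circ> q) = inv_into UNIV q \<circ> inv_into UNIV p"
    using * by (intro o_inv_distrib permutes_bij)
  ultimately show ?thesis
    unfolding g code_group_mult word_act_def by (auto simp: fun_eq_iff)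
qed

end

theory Submission
  imports Defs
begin

text \<open>Let \<open>W\<close> be a self-orthogonal code with \<open>2 ^ k\<close> words. Character sums give
  \<open>card W * card (dual_code n W) = 4 ^ n\<close>. The parity of the weight is a quadratic form polarizing
  to the inner product, and for even \<open>W\<close> the sum of \<open>(- 1) ^ wt n x\<close> over the dual of \<open>W\<close> is
  \<open>(- 2) ^ n\<close>, independently of \<open>W\<close>. This determines the number of (even) words \<open>v\<close> by which \<open>W\<close>
  can be enlarged, and double counting the pairs \<open>(v, L)\<close> with \<open>L\<close> self-dual, \<open>W \<subseteq> L\<close> and
  \<open>v \<in> L - W\<close> shows by induction on \<open>n - k\<close> that the number of such \<open>L\<close> is a product of
  factors \<open>2 ^ i + 1\<close>, with \<open>1 \<le> i \<le> n - k\<close> in general and \<open>0 \<le> i < n - k\<close> in the even case.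
  The mass formulas are the orbit-stabilizer theorem.\<close>

section \<open>Characters of the word group\<close>

lemma UNIV_klein: "(UNIV :: klein set) = {K0, Ka, Kb, Kc}"
  using klein.exhaust by blast

lemma words_eq: "carrier (klein_power n) = {1..n} \<rightarrow>\<^sub>E UNIV"
  by (simp add: klein_power_def klein_group_def)

lemma klein_power_mult: "x \<otimes>\<^bsub>klein_power n\<^esub> y = (\<lambda>i\<in>{1..n}. klein_add (x i) (y i))"
  by (simp add: klein_power_def klein_group_def)

lemma klein_power_one: "\<one>\<^bsub>klein_power n\<^esub> = (\<lambda>i\<in>{1..n}. K0)"
  by (simp add: klein_power_def klein_group_def)

lemma finite_words: "finite (carrier (klein_power n))"
  unfolding words_eq by (intro finite_PiE) (auto simp: UNIV_klein)

lemma card_words: "card (carrier (klein_power n)) = 4 ^ n"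
proof -
  have "card (UNIV :: klein set) = 4" by (simp add: UNIV_klein)
  then show ?thesis by (simp add: words_eq card_PiE)
qed

lemma comm_group_klein_power: "comm_group (klein_power n)"
proof (rule group.group_comm_groupI[OF group_klein_power])
  fix x y
  have "klein_add a b = klein_add b a" for a b
    by (cases a; cases b) simp_all
  then show "x \<otimes>\<^bsub>klein_power n\<^esub> y = y \<otimes>\<^bsub>klein_power n\<^esub> x"
    by (simp add: klein_power_mult)
qed

lemma word_add_self: "x \<otimes>\<^bsub>klein_power n\<^esub> x = \<one>\<^bsub>klein_power n\<^esub>"
  by (simp add: klein_power_mult klein_power_one klein_add_self)

lemma word_inv:
  assumes "x \<in> carrier (klein_power n)"
  shows "inv\<^bsub>klein_power n\<^esub> x = x"
  using group.inv_equality[OF group_klein_power word_add_self assms assms] .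

lemma word_add_add_self:
  assumes "x \<in> carrier (klein_power n)" "y \<in> carrier (klein_power n)"
  shows "x \<otimes>\<^bsub>klein_power n\<^esub> (x \<otimes>\<^bsub>klein_power n\<^esub> y) = y"
proof -
  interpret group "klein_power n" by (rule group_klein_power)
  show ?thesis using assms by (simp add: m_assoc[symmetric] word_add_self)
qed

text \<open>Translation by \<open>h\<close> is its own inverse. It supplies the change of variable
  in the character sums below.\<close>

lemma bij_betw_word_add:
  assumes "subgroup H (klein_power n)" "h \<in> H"
  shows "bij_betw ((\<otimes>\<^bsub>klein_power n\<^esub>) h) H H"
proof (rule bij_betw_byWitness[where f' = "(\<otimes>\<^bsub>klein_power n\<^esub>) h"])
  have "h \<in> carrier (klein_power n)" "H \<subseteq> carrier (klein_power n)"
    using assms by (auto dest: subgroup.subset)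
  then show "\<forall>x\<in>H. h \<otimes>\<^bsub>klein_power n\<^esub> (h \<otimes>\<^bsub>klein_power n\<^esub> x) = x"
    by (auto intro: word_add_add_self)
  then show "\<forall>x\<in>H. h \<otimes>\<^bsub>klein_power n\<^esub> (h \<otimes>\<^bsub>klein_power n\<^esub> x) = x" .
qed (use assms in \<open>auto intro: subgroup.m_closed\<close>)

lemma word_form_add:
  "word_form n (x \<otimes>\<^bsub>klein_power n\<^esub> y) z = word_form n x z + word_form n y z"
proof -
  have "word_form n (x \<otimes>\<^bsub>klein_power n\<^esub> y) z =
      (\<Sum>i=1..n. klein_dot (x i) (z i) + klein_dot (y i) (z i))"
    unfolding word_form_def by (intro sum.cong refl) (simp add: klein_power_mult klein_dot_add del: add_bit_eq_xor)
  then show ?thesis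
    by (simp add: word_form_def sum.distrib del: add_bit_eq_xor)
qed

lemma word_form_commute: "word_form n x y = word_form n y x"
  unfolding word_form_def by (intro sum.cong refl) (auto simp: klein_dot_def)

lemma word_form_self: "word_form n x x = 0"
  by (simp add: word_form_def klein_dot_def)

lemma word_form_one: "word_form n \<one>\<^bsub>klein_power n\<^esub> y = 0"
  unfolding word_form_def by (intro sum.neutral) (auto simp: klein_dot_def klein_power_one)

text \<open>The nontrivial character of the two-element field. Composed with
  \<open>word_form n x\<close> it gives a character of the word group.\<close>

definition bit_sign :: "bit \<Rightarrow> int" where
  "bit_sign b = (if b = 0 then 1 else - 1)"

lemma bit_sign_0 [simp]: "bit_sign 0 = 1"
  by (simp add: bit_sign_def)

lemma bit_sign_add: "bit_sign (a + b) = bit_sign a * bit_sign b"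
  by (cases "a = 0"; cases "b = 0") (auto simp: bit_sign_def)

lemma bit_sign_sum: "bit_sign (\<Sum>i\<in>A. f i) = (\<Prod>i\<in>A. bit_sign (f i))"
  by (induction A rule: infinite_finite_induct) (simp_all add: bit_sign_add del: add_bit_eq_xor)

section \<open>Dual codes and their cardinality\<close>

lemma dual_code_iff:
  "x \<in> dual_code n C \<longleftrightarrow> x \<in> carrier (klein_power n) \<and> (\<forall>y\<in>C. word_form n x y = 0)"
  by (simp add: dual_code_def)

lemma linear_dual_code: "linear_code n (dual_code n C)"
  unfolding linear_code_def
proof (rule group.subgroupI[OF group_klein_power])
  interpret group "klein_power n" by (rule group_klein_power)
  show "dual_code n C \<subseteq> carrier (klein_power n)" by (auto simp: dual_code_iff)
  have "\<one>\<^bsub>klein_power n\<^esub> \<in> dual_code n C" by (simp add: dual_code_iff word_form_one)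
  then show "dual_code n C \<noteq> {}" by blast
  show "inv\<^bsub>klein_power n\<^esub> x \<in> dual_code n C" if "x \<in> dual_code n C" for x
    using that word_inv by (auto simp: dual_code_iff)
  show "x \<otimes>\<^bsub>klein_power n\<^esub> y \<in> dual_code n C"
    if "x \<in> dual_code n C" "y \<in> dual_code n C" for x y
    using that by (auto simp: dual_code_iff word_form_add)
qed

text \<open>A dual code is always a subgroup, so the fixed-point equation already forces
  linearity.\<close>

lemma self_dual_codes_eq: "self_dual_codes n = {C. C = dual_code n C}"
proof -
  have "linear_code n C" if "C = dual_code n C" for C
    using linear_dual_code[of n C] that by simp
  then show ?thesis by (auto simp: self_dual_codes_def self_dual_def)
qed

text \<open>Nondegeneracy of the form: a nonzero entry of \<open>x\<close> is detected by a word
  supported on that single coordinate.\<close>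

lemma dual_code_words: "dual_code n (carrier (klein_power n)) = {\<one>\<^bsub>klein_power n\<^esub>}"
proof -
  interpret group "klein_power n" by (rule group_klein_power)
  have "x = \<one>\<^bsub>klein_power n\<^esub>" if x: "x \<in> dual_code n (carrier (klein_power n))" for x
  proof (rule ccontr)
    assume neq: "x \<noteq> \<one>\<^bsub>klein_power n\<^esub>"
    have xc: "x \<in> {1..n} \<rightarrow>\<^sub>E UNIV" using x by (simp add: dual_code_iff words_eq)
    obtain i where i: "i \<in> {1..n}" "x i \<noteq> K0"
      using neq xc by (auto simp: klein_power_one fun_eq_iff PiE_iff extensional_def split: if_splits)
    \<comment> \<open>Any nonzero letter other than \<open>x i\<close> works; one of
      \<open>Ka\<close> and \<open>Kb\<close> always qualifies.\<close>
    obtain c where c: "klein_dot (x i) c = 1"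
      using i(2) by (cases "x i") (auto simp: klein_dot_def intro: that[of Ka] that[of Kb])
    define y where "y = (\<lambda>j\<in>{1..n}. if j = i then c else K0)"
    have "word_form n x y = (\<Sum>j=1..n. if j = i then 1 else 0)"
      unfolding word_form_def y_def using c by (intro sum.cong refl) (auto simp: klein_dot_def)
    also have "\<dots> = 1" using i by simp
    finally show False using x by (auto simp: dual_code_iff words_eq y_def)
  qed
  moreover have "\<one>\<^bsub>klein_power n\<^esub> \<in> dual_code n (carrier (klein_power n))"
    by (simp add: dual_code_iff word_form_one)
  ultimately show ?thesis by blast
qed

lemma dual_code_one: "dual_code n {\<one>\<^bsub>klein_power n\<^esub>} = carrier (klein_power n)"
  using word_form_one word_form_commute by (auto simp: dual_code_iff)

text \<open>Orthogonality of characters: if the character is nontrivial on \<open>W\<close>,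
  translating by some \<open>h\<close> on which it takes the value -1 negates the sum, which
  therefore vanishes.\<close>

lemma character_sum:
  assumes "linear_code n W" "x \<in> carrier (klein_power n)"
  shows "(\<Sum>w\<in>W. bit_sign (word_form n x w)) = (if x \<in> dual_code n W then int (card W) else 0)"
proof (cases "x \<in> dual_code n W")
  case False
  then obtain h where h: "h \<in> W" "word_form n x h \<noteq> 0" using assms by (auto simp: dual_code_iff)
  have "(\<Sum>w\<in>W. bit_sign (word_form n x w)) = (\<Sum>w\<in>W. bit_sign (word_form n x (h \<otimes>\<^bsub>klein_power n\<^esub> w)))"
    using bij_betw_word_add h assms(1) unfolding linear_code_def
    by (intro sum.reindex_bij_betw[symmetric]) blast
  also have "\<dots> = (\<Sum>w\<in>W. - bit_sign (word_form n x w))"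
  proof (intro sum.cong refl)
    fix w
    have "word_form n x (h \<otimes>\<^bsub>klein_power n\<^esub> w) = word_form n x h + word_form n x w"
      using word_form_add word_form_commute by metis
    then show "bit_sign (word_form n x (h \<otimes>\<^bsub>klein_power n\<^esub> w)) = - bit_sign (word_form n x w)"
      using h(2) by (simp only: bit_sign_add) (simp add: bit_sign_def)
  qed
  finally show ?thesis using False by (simp add: sum_negf)
qed (simp add: dual_code_iff)

lemma linear_code_words: "linear_code n (carrier (klein_power n))"
  unfolding linear_code_def using group.subgroup_self[OF group_klein_power] .

lemma linear_code_subset: "linear_code n C \<Longrightarrow> C \<subseteq> carrier (klein_power n)"
  by (simp add: linear_code_def subgroup.subset)

lemma finite_linear_code: "linear_code n C \<Longrightarrow> finite C"
  using finite_subset[OF linear_code_subset finite_words] .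

text \<open>The sum of all signs over pairs of a word and a codeword is evaluated in both
  orders.\<close>

lemma card_dual_code:
  assumes W: "linear_code n W"
  shows "card W * card (dual_code n W) = 4 ^ n"
proof -
  let ?V = "carrier (klein_power n)"
  have sub: "W \<subseteq> ?V" and fin: "finite W" using W linear_code_subset finite_linear_code by auto
  have one: "\<one>\<^bsub>klein_power n\<^esub> \<in> W" using W unfolding linear_code_def by (rule subgroup.one_closed)
  have "int (card W * card (dual_code n W)) = (\<Sum>x\<in>dual_code n W. int (card W))" by simp
  also have "\<dots> = (\<Sum>x\<in>?V. if x \<in> dual_code n W then int (card W) else 0)"
    using finite_words by (intro sum.mono_neutral_cong_left) (auto simp: dual_code_iff)
  also have "\<dots> = (\<Sum>x\<in>?V. \<Sum>w\<in>W. bit_sign (word_form n x w))"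
    using character_sum[OF W] by simp
  also have "\<dots> = (\<Sum>w\<in>W. \<Sum>x\<in>?V. bit_sign (word_form n w x))"
    by (subst sum.swap) (simp only: word_form_commute)
  \<comment> \<open>The inner sum now runs over all words, so by nondegeneracy only the zero
    codeword contributes.\<close>
  also have "\<dots> = (\<Sum>w\<in>W. if w = \<one>\<^bsub>klein_power n\<^esub> then 4 ^ n else 0)"
    using sub character_sum[OF linear_code_words]
    by (intro sum.cong refl) (auto simp: dual_code_words card_words)
  also have "\<dots> = int (4 ^ n)" using one fin by simp
  finally show ?thesis by linarith
qed

text \<open>The quotient of \<open>4 ^ n\<close> by \<open>2 ^ k\<close>, with \<open>m\<close> for
  the codimension so that neither division nor truncated subtraction appears.\<close>

lemma card_dual_code_pow2:
  assumes "linear_code n W" "card W = 2 ^ k" "k + m = n"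
  shows "card (dual_code n W) = 2 ^ k * 2 ^ m * 2 ^ m"
proof -
  have "(4::nat) ^ n = 2 ^ k * (2 ^ k * 2 ^ m * 2 ^ m)"
  proof -
    have "(4::nat) ^ n = 2 ^ n * 2 ^ n" by (simp flip: power_mult_distrib)
    then show ?thesis using assms(3) by (auto simp: power_add)
  qed
  then show ?thesis using card_dual_code[OF assms(1)] assms(2) by simp
qed

lemma card_self_dual:
  assumes "C \<in> self_dual_codes n"
  shows "card C = 2 ^ n"
proof -
  have "(card C)\<^sup>2 = (2 ^ n)\<^sup>2"
    using assms card_dual_code[of n C]
    by (simp add: self_dual_codes_def self_dual_def power2_eq_square flip: power_mult_distrib)
  then show ?thesis by simp
qed

lemma dual_code_antimono: "C \<subseteq> D \<Longrightarrow> dual_code n D \<subseteq> dual_code n C"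
  unfolding dual_code_def by blast

lemma finite_self_dual_codes: "finite (self_dual_codes n)"
  by (rule finite_subset[of _ "Pow (carrier (klein_power n))"])
    (auto simp: self_dual_codes_def finite_words dest: linear_code_subset)

section \<open>Self-dual codes containing a given self-orthogonal code\<close>

text \<open>Words have order two, so \<open>W\<close> and \<open>v\<close> generate just the two
  cosets of \<open>W\<close>, disjoint because \<open>v\<close> is outside \<open>W\<close>. The
  form is alternating, so \<open>v\<close> is orthogonal to itself as well as to
  \<open>W\<close>.\<close>

lemma adjoin_word:
  assumes W: "linear_code n W" "W \<subseteq> dual_code n W"
    and v: "v \<in> dual_code n W" "v \<notin> W"
  defines "W' \<equiv> W \<union> (\<otimes>\<^bsub>klein_power n\<^esub>) v ` W"
  shows "linear_code n W'" "W' \<subseteq> dual_code n W'" "card W' = 2 * card W" "v \<in> W'"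
proof -
  interpret comm_group "klein_power n" by (rule comm_group_klein_power)
  interpret W: subgroup W "klein_power n" using W(1) by (simp add: linear_code_def)
  have vV: "v \<in> carrier (klein_power n)" and vW: "\<And>w. w \<in> W \<Longrightarrow> word_form n v w = 0"
    using v by (auto simp: dual_code_iff)
  have WW: "word_form n w u = 0" if "w \<in> W" "u \<in> W" for w u
    using subsetD[OF W(2) that(1)] that(2) by (simp add: dual_code_iff)
  have W'V: "W' \<subseteq> carrier (klein_power n)" using vV W.subset by (auto simp: W'_def)
  \<comment> \<open>Moving \<open>v\<close> to the front shows that a sum lies in one of the two
    cosets; two copies of \<open>v\<close> cancel.\<close>
  have swap: "w \<otimes>\<^bsub>klein_power n\<^esub> (v \<otimes>\<^bsub>klein_power n\<^esub> u) = v \<otimes>\<^bsub>klein_power n\<^esub> (w \<otimes>\<^bsub>klein_power n\<^esub> u)"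
    if "w \<in> W" "u \<in> W" for w u
    using that vV by (simp add: m_lcomm)
  show "linear_code n W'" unfolding linear_code_def
  proof (rule subgroupI)
    show "W' \<noteq> {}" using W.one_closed unfolding W'_def by blast
    show "inv\<^bsub>klein_power n\<^esub> x \<in> W'" if "x \<in> W'" for x
      using that word_inv[OF subsetD[OF W'V that]] by simp
    show "x \<otimes>\<^bsub>klein_power n\<^esub> y \<in> W'" if "x \<in> W'" "y \<in> W'" for x y
      using that vV by (auto simp: W'_def swap m_assoc word_add_add_self)
  qed (rule W'V)
  show "W' \<subseteq> dual_code n W'"
  proof
    fix x assume x: "x \<in> W'"
    have c: "word_form n w v = 0" if "w \<in> W" for w
      using vW[OF that] word_form_commute[of n w v] by simp
    have "word_form n x y = 0" if "y \<in> W'" for y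
    proof -
      have r: "word_form n z (v \<otimes>\<^bsub>klein_power n\<^esub> u) = word_form n z v + word_form n z u" for z u
        by (simp only: word_form_commute[of n z] word_form_add)
      show ?thesis using x that unfolding W'_def
        by (elim UnE imageE) (simp_all add: word_form_add r vW c WW word_form_self)
    qed
    then show "x \<in> dual_code n W'" using subsetD[OF W'V x] by (simp add: dual_code_iff)
  qed
  have disj: "W \<inter> (\<otimes>\<^bsub>klein_power n\<^esub>) v ` W = {}"
  proof (rule ccontr)
    assume "W \<inter> (\<otimes>\<^bsub>klein_power n\<^esub>) v ` W \<noteq> {}"
    then obtain w where w: "w \<in> W" "v \<otimes>\<^bsub>klein_power n\<^esub> w \<in> W" by blast
    then have "v \<otimes>\<^bsub>klein_power n\<^esub> w \<otimes>\<^bsub>klein_power n\<^esub> w \<in> W" by blast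
    moreover have "v \<otimes>\<^bsub>klein_power n\<^esub> w \<otimes>\<^bsub>klein_power n\<^esub> w = v"
      using w(1) vV by (simp add: m_assoc word_add_self)
    ultimately show False using v(2) by simp
  qed
  have "card ((\<otimes>\<^bsub>klein_power n\<^esub>) v ` W) = card W"
    using vV W.mem_carrier
    by (intro card_image inj_on_inverseI[where g = "(\<otimes>\<^bsub>klein_power n\<^esub>) v"] word_add_add_self)
  then show "card W' = 2 * card W"
    using card_Un_disjoint[OF finite_linear_code[OF W(1)] finite_imageI[OF finite_linear_code[OF W(1)]] disj]
    unfolding W'_def by linarith
  show "v \<in> W'" unfolding W'_def
    using vV by (intro UnI2 image_eqI[of _ _ "\<one>\<^bsub>klein_power n\<^esub>"]) simp_all
qed

text \<open>For \<open>v \<in> L - W\<close>, the codes \<open>L\<close> containing \<open>W\<close> and \<open>v\<close> are the ones containing the larger code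
  generated by both. The set \<open>S\<close> stands for either all words or the even words.\<close>

lemma card_self_dual_codes_between:
  fixes a :: "nat \<Rightarrow> nat"
  assumes add: "\<And>v w. v \<in> S \<Longrightarrow> w \<in> S \<Longrightarrow> word_form n v w = 0 \<Longrightarrow> v \<otimes>\<^bsub>klein_power n\<^esub> w \<in> S"
    and count: "\<And>W k m. linear_code n W \<Longrightarrow> W \<subseteq> dual_code n W \<Longrightarrow> W \<subseteq> S \<Longrightarrow> card W = 2 ^ k \<Longrightarrow>
      k + Suc m = n \<Longrightarrow> card (dual_code n W \<inter> S) = 2 ^ k + a (Suc m) * (2 ^ n - 2 ^ k)"
    and "linear_code n W" "W \<subseteq> dual_code n W" "W \<subseteq> S" "card W = 2 ^ k" "k + m = n"
  shows "card {L \<in> self_dual_codes n. W \<subseteq> L \<and> L \<subseteq> S} = (\<Prod>i=1..m. a i)"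
  using assms(3-)
proof (induction m arbitrary: W k)
  case 0
  \<comment> \<open>Here \<open>k = n\<close>, so \<open>W\<close> and its dual have equal size and
    \<open>W\<close> is already self-dual.\<close>
  have "card (dual_code n W) = 2 ^ n"
    using card_dual_code_pow2[OF 0(1,4,5)] 0(5) by simp
  then have "W = dual_code n W"
    using 0 card_subset_eq finite_linear_code linear_dual_code by (metis add.right_neutral)
  then have "W \<in> self_dual_codes n" by (simp add: self_dual_codes_eq)
  moreover have "L = W" if "L \<in> self_dual_codes n" "W \<subseteq> L" for L
  proof -
    have "finite L" using that finite_linear_code by (auto simp: self_dual_codes_def)
    then show ?thesis using that 0 card_self_dual[OF that(1)] card_subset_eq by (metis add.right_neutral)
  qed
  ultimately have "{L \<in> self_dual_codes n. W \<subseteq> L \<and> L \<subseteq> S} = {W}" using 0(3) by blast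
  then show ?case by simp
next
  case (Suc m)
  interpret subgroup W "klein_power n" using Suc.prems by (simp add: linear_code_def)
  let ?F = "{L \<in> self_dual_codes n. W \<subseteq> L \<and> L \<subseteq> S}"
  let ?T = "dual_code n W \<inter> S - W"
  let ?P = "\<Prod>i=1..m. a i"
  have finW: "finite W" and finD: "finite (dual_code n W)"
    using Suc.prems(1) finite_linear_code linear_dual_code by blast+
  have kn: "(2::nat) ^ k < 2 ^ n" using Suc.prems(5) by simp
  \<comment> \<open>\<open>W\<close> lies in both its dual and \<open>S\<close>, so removing it
    takes away exactly the summand \<open>2 ^ k\<close> in \<open>count\<close>.\<close>
  have cardT: "card ?T = a (Suc m) * (2 ^ n - 2 ^ k)"
    using count[OF Suc.prems] Suc.prems finW by (simp add: card_Diff_subset)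
  have "(\<Sum>L\<in>?F. card {v \<in> ?T. v \<in> L}) = ?P * card ?T"
  proof (rule sum_multicount)
    show "finite ?F" using finite_self_dual_codes by simp
    show "finite ?T" using finD by simp
    show "\<forall>v\<in>?T. card {L \<in> ?F. v \<in> L} = ?P"
    proof
      fix v assume v: "v \<in> ?T"
      define W' where "W' = W \<union> (\<otimes>\<^bsub>klein_power n\<^esub>) v ` W"
      note ad = adjoin_word[OF Suc.prems(1,2), of v, folded W'_def]
      \<comment> \<open>\<open>v\<close> is orthogonal to \<open>W\<close>, so \<open>add\<close>
        applies to every sum in the new coset.\<close>
      have "W' \<subseteq> S" using v Suc.prems(3) by (auto simp: W'_def dual_code_iff intro!: add)
      then have "card {L \<in> self_dual_codes n. W' \<subseteq> L \<and> L \<subseteq> S} = ?P"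
        using v Suc.prems by (intro Suc.IH[of W' "Suc k"]) (auto simp: ad)
      moreover have "W' \<subseteq> L \<longleftrightarrow> W \<subseteq> L \<and> v \<in> L" if "L \<in> self_dual_codes n" for L
      proof -
        have "subgroup L (klein_power n)" using that by (auto simp: self_dual_codes_def linear_code_def)
        then show ?thesis using ad(4) v by (auto simp: W'_def intro: subgroup.m_closed)
      qed
      then have "{L \<in> ?F. v \<in> L} = {L \<in> self_dual_codes n. W' \<subseteq> L \<and> L \<subseteq> S}" by auto
      ultimately show "card {L \<in> ?F. v \<in> L} = ?P" by simp
    qed
  qed
  moreover have "card {v \<in> ?T. v \<in> L} = 2 ^ n - 2 ^ k" if L: "L \<in> ?F" for L
  proof -
    \<comment> \<open>Duality reverses inclusions and \<open>L\<close> is its own dual. Hence every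
      word of \<open>L - W\<close> is a candidate in \<open>?T\<close>.\<close>
    have "L \<subseteq> dual_code n W"
      using L dual_code_antimono[of W L n] by (auto simp: self_dual_codes_eq)
    then have "{v \<in> ?T. v \<in> L} = L - W" using L by auto
    moreover have "card L = 2 ^ n" using L card_self_dual by blast
    ultimately show ?thesis using L finW Suc.prems(4) by (simp add: card_Diff_subset)
  qed
  ultimately have "card ?F * (2 ^ n - 2 ^ k) = ?P * (a (Suc m) * (2 ^ n - 2 ^ k))"
    by (simp add: cardT)
  \<comment> \<open>The factor \<open>2 ^ n - 2 ^ k\<close> is positive by \<open>kn\<close> and
    cancels.\<close>
  then have "card ?F = ?P * a (Suc m)" using kn by simp
  then show ?case by simp
qed

lemma linear_code_one: "linear_code n {\<one>\<^bsub>klein_power n\<^esub>}"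
  unfolding linear_code_def using group.triv_subgroup[OF group_klein_power] .

text \<open>Every linear code contains the zero word, so this is the count above the zero code, with
  all words allowed.\<close>

lemma card_self_dual_codes: "card (self_dual_codes n) = (\<Prod>i=1..n. 2 ^ i + 1)"
proof -
  let ?o = "{\<one>\<^bsub>klein_power n\<^esub>}"
  have "card {L \<in> self_dual_codes n. ?o \<subseteq> L \<and> L \<subseteq> UNIV} = (\<Prod>i=1..n. 2 ^ i + 1)"
  proof (rule card_self_dual_codes_between[where k = 0])
    fix W k m assume "linear_code n W" "card W = 2 ^ k" "k + Suc m = n"
    then have "card (dual_code n W) = 2 ^ k * 2 ^ Suc m * 2 ^ Suc m" "n = k + Suc m"
      using card_dual_code_pow2 by blast+
    \<comment> \<open>With \<open>t = 2 ^ Suc m\<close> this is the factorization of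
      \<open>t * t - 1\<close> scaled by \<open>2 ^ k\<close>; it is the source of the factor
      \<open>2 ^ Suc m + 1\<close>.\<close>
    moreover have "2 ^ k * t * t = 2 ^ k + (t + 1) * (2 ^ k * t - 2 ^ k)" if "t \<ge> 1" for t :: nat
      using that by (auto simp: le_iff_add algebra_simps)
    ultimately show "card (dual_code n W \<inter> UNIV) = 2 ^ k + (2 ^ Suc m + 1) * (2 ^ n - 2 ^ k)"
      by (simp only: power_add Int_UNIV_right) simp
  qed (auto simp: linear_code_one dual_code_one group.is_monoid[OF group_klein_power])
  moreover have "{L \<in> self_dual_codes n. ?o \<subseteq> L \<and> L \<subseteq> UNIV} = self_dual_codes n"
    by (auto simp: self_dual_codes_def linear_code_def subgroup.one_closed)
  ultimately show ?thesis by simp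
qed

section \<open>Even codes\<close>

text \<open>The sign of the weight factors over the coordinates, which reduces the next two lemmas
  to single letters.\<close>

lemma wt_sign: "(- 1 :: int) ^ wt n x = (\<Prod>i=1..n. if x i = K0 then 1 else - 1)"
proof -
  have "(\<Prod>i=1..n. if x i \<noteq> K0 then - 1 else 1 :: int) = (- 1) ^ wt n x"
    unfolding wt_def by (subst prod.inter_filter[symmetric]) simp_all
  moreover have "(\<Prod>i=1..n. if x i \<noteq> K0 then - 1 else 1 :: int) = (\<Prod>i=1..n. if x i = K0 then 1 else - 1)"
    by (rule prod.cong) auto
  ultimately show ?thesis by simp
qed

text \<open>Multiplicative form of the polarization identity for the parity of the weight, checked
  on pairs of letters.\<close>

lemma wt_sign_add:
  "(- 1 :: int) ^ wt n (x \<otimes>\<^bsub>klein_power n\<^esub> y) =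
    (- 1) ^ wt n x * (- 1) ^ wt n y * bit_sign (word_form n x y)"
proof -
  have *: "(if klein_add a b = K0 then 1 else - 1) =
      (if a = K0 then 1 else - 1) * (if b = K0 then 1 else - 1) * bit_sign (klein_dot a b)" for a b
    by (cases a; cases b) (simp_all add: klein_dot_def bit_sign_def)
  show ?thesis
    unfolding wt_sign word_form_def bit_sign_sum prod.distrib[symmetric]
    by (intro prod.cong refl) (simp add: klein_power_mult *)
qed

text \<open>The sum factors, and each coordinate contributes 1 - 1 - 1 - 1 = -2.\<close>

lemma sum_wt_sign: "(\<Sum>x\<in>carrier (klein_power n). (- 1 :: int) ^ wt n x) = (- 2) ^ n"
proof -
  have "(\<Prod>i\<in>{1..n}. \<Sum>c\<in>(UNIV::klein set). if c = K0 then 1 else - 1 :: int) =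
      (\<Sum>x\<in>{1..n} \<rightarrow>\<^sub>E UNIV. \<Prod>i\<in>{1..n}. if x i = K0 then 1 else - 1)"
    by (rule prod_sum_PiE) (auto simp: UNIV_klein)
  then show ?thesis by (simp add: wt_sign words_eq UNIV_klein)
qed

text \<open>The indicator of the dual is replaced by a character sum over \<open>W\<close>. As
  \<open>w\<close> in \<open>W\<close> has even weight, the character merges with the weight sign of
  \<open>x\<close> into that of \<open>w\<close> plus \<open>x\<close>, and translation by
  \<open>w\<close> leaves the sum over all words unchanged.\<close>

lemma sum_dual_code_wt_sign:
  assumes W: "linear_code n W" and ev: "even_code n W"
  shows "(\<Sum>x\<in>dual_code n W. (- 1 :: int) ^ wt n x) = (- 2) ^ n"
proof -
  let ?V = "carrier (klein_power n)"
  interpret W: subgroup W "klein_power n" using W by (simp add: linear_code_def)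
  interpret comm_group "klein_power n" by (rule comm_group_klein_power)
  have fin: "finite W" using W finite_linear_code by auto
  have "int (card W) * (\<Sum>x\<in>dual_code n W. (- 1) ^ wt n x) =
      (\<Sum>x\<in>?V. (- 1) ^ wt n x * (if x \<in> dual_code n W then int (card W) else 0))"
    unfolding sum_distrib_left
    using finite_words by (intro sum.mono_neutral_cong_left) (auto simp: dual_code_iff)
  also have "\<dots> = (\<Sum>x\<in>?V. \<Sum>w\<in>W. (- 1) ^ wt n x * bit_sign (word_form n x w))"
    using character_sum[OF W] by (simp flip: sum_distrib_left)
  also have "\<dots> = (\<Sum>w\<in>W. \<Sum>x\<in>?V. (- 1) ^ wt n x * bit_sign (word_form n x w))"
    by (rule sum.swap)
  also have "\<dots> = (\<Sum>w\<in>W. \<Sum>x\<in>?V. (- 1) ^ wt n (w \<otimes>\<^bsub>klein_power n\<^esub> x))"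
  proof (intro sum.cong refl)
    fix w x assume "w \<in> W" "x \<in> ?V"
    then have "even (wt n w)" using ev by (simp add: even_code_def)
    then show "(- 1) ^ wt n x * bit_sign (word_form n x w) = (- 1 :: int) ^ wt n (w \<otimes>\<^bsub>klein_power n\<^esub> x)"
      by (simp add: wt_sign_add word_form_commute)
  qed
  also have "\<dots> = (\<Sum>w\<in>W. \<Sum>x\<in>?V. (- 1) ^ wt n x)"
    using bij_betw_word_add[OF subgroup_self]
    by (intro sum.cong refl sum.reindex_bij_betw) auto
  finally have "int (card W) * (\<Sum>x\<in>dual_code n W. (- 1) ^ wt n x) = int (card W) * (- 2) ^ n"
    by (simp add: sum_wt_sign)
  moreover have "card W \<noteq> 0" using fin W.one_closed by (metis card_0_eq empty_iff)
  ultimately show ?thesis by simp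
qed

text \<open>The sign sum is the number of even words in the dual minus the number of odd ones;
  together with the size of the dual it determines the former. The exponent \<open>i - 1\<close>
  fits the index range of \<open>card_self_dual_codes_between\<close>.\<close>

lemma card_even_self_dual_codes:
  assumes n: "even n"
  shows "card (even_self_dual_codes n) = (\<Prod>i=1..n. 2 ^ (i - 1) + 1)"
proof -
  let ?o = "{\<one>\<^bsub>klein_power n\<^esub>}"
  let ?S = "{x. even (wt n x)}"
  have "card {L \<in> self_dual_codes n. ?o \<subseteq> L \<and> L \<subseteq> ?S} = (\<Prod>i=1..n. 2 ^ (i - 1) + 1)"
  proof (rule card_self_dual_codes_between[where k = 0])
    fix v w assume vw: "v \<in> ?S" "w \<in> ?S" "word_form n v w = 0"
    then have "(- 1 :: int) ^ wt n (v \<otimes>\<^bsub>klein_power n\<^esub> w) = 1" by (simp add: wt_sign_add)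
    then show "v \<otimes>\<^bsub>klein_power n\<^esub> w \<in> ?S"
      by (metis mem_Collect_eq neg_one_odd_power one_neq_neg_one)
  next
    fix W k m
    assume W: "linear_code n W" "W \<subseteq> ?S" "card W = 2 ^ k" "k + Suc m = n"
    let ?D = "dual_code n W"
    have fin: "finite ?D" using linear_dual_code finite_linear_code by blast
    \<comment> \<open>Evenness of \<open>n\<close> turns \<open>(- 2) ^ n\<close> into
      \<open>2 ^ n\<close>.\<close>
    have "(\<Sum>x\<in>?D. (- 1 :: int) ^ wt n x) = 2 ^ n"
      using sum_dual_code_wt_sign[OF W(1)] W(2) n by (auto simp: even_code_def)
    moreover have "(\<Sum>x\<in>?D. (- 1 :: int) ^ wt n x) = int (card (?D \<inter> ?S)) - int (card (?D - ?S))"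
    proof -
      have "(\<Sum>x\<in>?D. (- 1 :: int) ^ wt n x) =
          (\<Sum>x\<in>?D \<inter> ?S. (- 1) ^ wt n x) + (\<Sum>x\<in>?D - ?S. (- 1) ^ wt n x)"
        using fin by (metis sum.Int_Diff)
      also have "(\<Sum>x\<in>?D \<inter> ?S. (- 1 :: int) ^ wt n x) = (\<Sum>x\<in>?D \<inter> ?S. 1)" by (rule sum.cong) auto
      also have "(\<Sum>x\<in>?D - ?S. (- 1 :: int) ^ wt n x) = (\<Sum>x\<in>?D - ?S. - 1)" by (rule sum.cong) auto
      finally show ?thesis by simp
    qed
    moreover have "card ?D = card (?D \<inter> ?S) + card (?D - ?S)"
      using fin by (metis card_Int_Diff)
    moreover have "card ?D = 2 ^ k * 2 ^ Suc m * 2 ^ Suc m"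
      using card_dual_code_pow2 W by blast
    \<comment> \<open>Adding the difference and the total counts the even words twice.\<close>
    ultimately have "2 * int (card (?D \<inter> ?S)) = 2 ^ n + 2 ^ k * 2 ^ Suc m * 2 ^ Suc m"
      by (auto dest: arg_cong[of _ _ int])
    then have "int (card (?D \<inter> ?S)) = 2 ^ k * 2 ^ m + 2 * 2 ^ k * 2 ^ m * 2 ^ m"
      using W(4)[symmetric] by (simp add: power_add)
    moreover have "int (2 ^ k + (2 ^ m + 1) * (2 ^ n - 2 ^ k)) = 2 ^ k * 2 ^ m + 2 * 2 ^ k * 2 ^ m * 2 ^ m"
    proof -
      have "(2::nat) ^ k \<le> 2 ^ n" using W(4) by simp
      then have "int (2 ^ k + (2 ^ m + 1) * (2 ^ n - 2 ^ k)) = 2 ^ k + (2 ^ m + 1) * (2 ^ n - 2 ^ k)"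
        by (simp only: of_nat_add of_nat_mult of_nat_diff of_nat_power) simp
      then show ?thesis using W(4)[symmetric] by (simp add: power_add algebra_simps)
    qed
    ultimately show "card (?D \<inter> ?S) = 2 ^ k + (2 ^ (Suc m - 1) + 1) * (2 ^ n - 2 ^ k)"
      by (metis diff_Suc_1 of_nat_eq_iff)
  next
    have "{i \<in> {1..n}. \<one>\<^bsub>klein_power n\<^esub> i \<noteq> K0} = {}" by (auto simp: klein_power_one)
    then have "wt n \<one>\<^bsub>klein_power n\<^esub> = 0" by (simp only: wt_def card.empty)
    then show "?o \<subseteq> ?S" by simp
  qed (auto simp: linear_code_one dual_code_one group.is_monoid[OF group_klein_power])
  moreover have "{L \<in> self_dual_codes n. ?o \<subseteq> L \<and> L \<subseteq> ?S} = even_self_dual_codes n"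
    by (auto simp: self_dual_codes_def even_self_dual_codes_def even_code_def linear_code_def
        subgroup.one_closed)
  ultimately show ?thesis by simp
qed

section \<open>The mass formula\<close>

lemma word_act_closed: "word_act n g x \<in> carrier (klein_power n)"
  by (cases g) (simp add: word_act_def words_eq)

lemma word_act_inverse:
  assumes "g \<in> carrier (code_group n)" "x \<in> carrier (klein_power n)"
  shows "word_act n g (word_act n (inv\<^bsub>code_group n\<^esub> g) x) = x"
proof -
  interpret group "code_group n" by (rule group_code_group)
  show ?thesis using assms by (metis inv_closed r_inv word_act_mult word_act_one)
qed

text \<open>A letter permutation fixes \<open>K0\<close> and is injective, which is all that
  \<open>klein_dot\<close> and the weight depend on; the coordinate permutation only reindexes the
  sums.\<close>

lemma word_act_isometry:
  assumes "g \<in> carrier (code_group n)"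
  shows "word_form n (word_act n g x) (word_act n g y) = word_form n x y"
    and "wt n (word_act n g x) = wt n x"
proof -
  obtain s p where g: "g = (s, p)" and s: "\<And>i. i \<in> {1..n} \<Longrightarrow> s i permutes {Ka, Kb, Kc}"
    and p: "p permutes {1..n}"
    using assms by (cases g) (auto simp: code_group_carrier PiE_iff)
  have inj: "s i c = s i d \<longleftrightarrow> c = d" if "i \<in> {1..n}" for i c d
    using permutes_inj[OF s[OF that]] by (rule inj_eq)
  have K0: "s i c = K0 \<longleftrightarrow> c = K0" if "i \<in> {1..n}" for i c
  proof -
    have "s i K0 = K0" using permutes_not_in[OF s[OF that]] by simp
    then show ?thesis using inj[OF that, of c K0] by simp
  qed
  have bij: "bij_betw (inv_into UNIV p) {1..n} {1..n}"
    using p by (intro permutes_imp_bij permutes_inv)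
  have "word_form n (word_act n g x) (word_act n g y) =
      (\<Sum>i=1..n. klein_dot (x (inv_into UNIV p i)) (y (inv_into UNIV p i)))"
    unfolding word_form_def word_act_def g
    by (intro sum.cong refl) (simp add: klein_dot_def K0 inj del: One_nat_def)
  also have "\<dots> = word_form n x y"
    unfolding word_form_def using sum.reindex_bij_betw[OF bij, of "\<lambda>i. klein_dot (x i) (y i)"] .
  finally show "word_form n (word_act n g x) (word_act n g y) = word_form n x y" .
  have "wt n (word_act n g x) = (\<Sum>i=1..n. if x (inv_into UNIV p i) = K0 then 0 else 1)"
    unfolding wt_def card_eq_sum word_act_def g
    by (subst sum.inter_filter) (auto simp: K0 intro!: sum.cong simp del: One_nat_def)
  also have "\<dots> = (\<Sum>i=1..n. if x i = K0 then 0 else 1)"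
    using sum.reindex_bij_betw[OF bij, of "\<lambda>i. if x i = K0 then 0 else 1 :: nat"] .
  also have "\<dots> = wt n x"
    unfolding wt_def card_eq_sum by (subst sum.inter_filter) (auto intro!: sum.cong)
  finally show "wt n (word_act n g x) = wt n x" .
qed

text \<open>By isometry, \<open>x\<close> is orthogonal to the image of \<open>C\<close> exactly if
  its preimage under \<open>g\<close> is orthogonal to \<open>C\<close>.\<close>

lemma dual_code_act:
  assumes g: "g \<in> carrier (code_group n)"
  shows "dual_code n (code_act n g C) = code_act n g (dual_code n C)"
proof (rule Set.set_eqI)
  fix x
  have "x \<in> dual_code n (code_act n g C) \<longleftrightarrow>
      x \<in> carrier (klein_power n) \<and> word_act n (inv\<^bsub>code_group n\<^esub> g) x \<in> dual_code n C"
    using word_act_isometry(1)[OF g, of "word_act n (inv\<^bsub>code_group n\<^esub> g) x"] word_act_inverse[OF g]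
    by (auto simp: dual_code_iff code_act_def word_act_closed)
  also have "\<dots> \<longleftrightarrow> x \<in> code_act n g (dual_code n C)"
  proof
    assume "x \<in> carrier (klein_power n) \<and> word_act n (inv\<^bsub>code_group n\<^esub> g) x \<in> dual_code n C"
    then show "x \<in> code_act n g (dual_code n C)"
      unfolding code_act_def using word_act_inverse[OF g] by (intro image_eqI) auto
  next
    interpret group "code_group n" by (rule group_code_group)
    assume "x \<in> code_act n g (dual_code n C)"
    then obtain y where y: "x = word_act n g y" "y \<in> dual_code n C" by (auto simp: code_act_def)
    \<comment> \<open>The inverse law is applied to the inverse of \<open>g\<close>, whose own
      inverse is \<open>g\<close>.\<close>
    then have "word_act n (inv\<^bsub>code_group n\<^esub> g) x = y"
      using word_act_inverse[of "inv\<^bsub>code_group n\<^esub> g" n y] g by (simp add: dual_code_iff)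
    then show "x \<in> carrier (klein_power n) \<and> word_act n (inv\<^bsub>code_group n\<^esub> g) x \<in> dual_code n C"
      using y word_act_closed by simp
  qed
  finally show "x \<in> dual_code n (code_act n g C) \<longleftrightarrow> x \<in> code_act n g (dual_code n C)" .
qed

lemma code_act_self_dual:
  assumes "g \<in> carrier (code_group n)" "C \<in> self_dual_codes n"
  shows "code_act n g C \<in> self_dual_codes n"
  using assms dual_code_act[of g n C] by (simp add: self_dual_codes_eq)

lemma code_act_even_self_dual:
  assumes "g \<in> carrier (code_group n)" "C \<in> even_self_dual_codes n"
  shows "code_act n g C \<in> even_self_dual_codes n"
  using assms code_act_self_dual[of g n C]
  by (auto simp: self_dual_codes_def even_self_dual_codes_def even_code_def code_act_def word_act_isometry)

text \<open>\<open>E\<close> is left abstract to cover both families of codes. The maps are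
  restricted because elements of \<open>BijGroup E\<close> are extensional on
  \<open>E\<close>.\<close>

lemma group_action_codes:
  assumes lin: "\<And>C. C \<in> E \<Longrightarrow> linear_code n C"
    and inv: "\<And>g C. g \<in> carrier (code_group n) \<Longrightarrow> C \<in> E \<Longrightarrow> code_act n g C \<in> E"
  shows "group_action (code_group n) E (\<lambda>g. restrict (code_act n g) E)"
proof -
  interpret group "code_group n" by (rule group_code_group)
  have one: "code_act n \<one>\<^bsub>code_group n\<^esub> C = C" if "C \<in> E" for C
    using linear_code_subset[OF lin[OF that]] by (force simp: code_act_def word_act_one)
  have mult: "code_act n (g \<otimes>\<^bsub>code_group n\<^esub> h) C = code_act n g (code_act n h C)"
    if "g \<in> carrier (code_group n)" "h \<in> carrier (code_group n)" for g h C
    using that by (simp add: code_act_def image_image word_act_mult)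
  have bij: "restrict (code_act n g) E \<in> Bij E" if g: "g \<in> carrier (code_group n)" for g
  proof -
    have "bij_betw (code_act n g) E E"
    proof (rule bij_betw_byWitness[where f' = "code_act n (inv\<^bsub>code_group n\<^esub> g)"])
      show "\<forall>C\<in>E. code_act n (inv\<^bsub>code_group n\<^esub> g) (code_act n g C) = C"
        using g by (simp add: one flip: mult)
      show "\<forall>C\<in>E. code_act n g (code_act n (inv\<^bsub>code_group n\<^esub> g) C) = C"
        using g by (simp add: one flip: mult)
    qed (use inv[OF g] inv[OF inv_closed[OF g]] in blast)+
    then show ?thesis by (simp add: Bij_def)
  qed
  have "(\<lambda>g. restrict (code_act n g) E) \<in> hom (code_group n) (BijGroup E)"
  proof (rule homI)
    fix g h assume gh: "g \<in> carrier (code_group n)" "h \<in> carrier (code_group n)"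
    show "restrict (code_act n (g \<otimes>\<^bsub>code_group n\<^esub> h)) E =
        restrict (code_act n g) E \<otimes>\<^bsub>BijGroup E\<^esub> restrict (code_act n h) E"
      using bij[OF gh(1)] bij[OF gh(2)] inv[OF gh(2)] mult[OF gh]
      by (simp add: BijGroup_def compose_def cong: restrict_cong)
  qed (simp add: BijGroup_def bij)
  then show ?thesis
    by (simp add: group_action_def group_hom_def group_hom_axioms_def group_BijGroup is_group)
qed

text \<open>Classes are orbits and partition \<open>E\<close>; by orbit-stabilizer each summand is
  the size of its class, whichever representative \<open>rep\<close> picks.\<close>

lemma mass_formula:
  assumes fin: "finite E"
    and lin: "\<And>C. C \<in> E \<Longrightarrow> linear_code n C"
    and inv: "\<And>g C. g \<in> carrier (code_group n) \<Longrightarrow> C \<in> E \<Longrightarrow> code_act n g C \<in> E"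
    and rep: "\<forall>Q\<in>E // code_equiv n. rep Q \<in> Q"
  shows "real (card E) =
    (\<Sum>Q\<in>E // code_equiv n. real (6 ^ n * fact n) / real (card (code_Aut n (rep Q))))"
proof -
  let ?\<phi> = "\<lambda>g. restrict (code_act n g) E"
  interpret group_action "code_group n" E ?\<phi> using lin inv by (rule group_action_codes)
  \<comment> \<open>\<open>code_equiv\<close> relates arbitrary linear codes, but invariance of
    \<open>E\<close> keeps the class of a member inside \<open>E\<close>.\<close>
  have cls: "code_equiv n `` {C} = orbit (code_group n) ?\<phi> C" if "C \<in> E" for C
    using that lin inv by (auto simp: code_equiv_def orbit_def)
  then have quot: "E // code_equiv n = orbits (code_group n) E ?\<phi>"
    by (auto simp: quotient_def orbits_def)
  have card_Q: "real (card Q) = real (6 ^ n * fact n) / real (card (code_Aut n (rep Q)))"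
    if Q: "Q \<in> E // code_equiv n" for Q
  proof -
    obtain C where C: "C \<in> E" "Q = orbit (code_group n) ?\<phi> C" using Q by (auto simp: quot orbits_def)
    have repQ: "rep Q \<in> Q" using rep Q by blast
    then have repE: "rep Q \<in> E" using orbits_coverture Q by (auto simp: quot)
    have "orbit (code_group n) ?\<phi> (rep Q) \<inter> Q \<noteq> {}"
      using orbit_refl[OF repE] repQ by blast
    \<comment> \<open>Orbits that meet coincide, so the stabilizer may be taken at the chosen
      representative.\<close>
    then have Q_eq: "orbit (code_group n) ?\<phi> (rep Q) = Q"
      using disjoint_union[of "orbit (code_group n) ?\<phi> (rep Q)" Q] repE Q by (auto simp: quot orbits_def)
    have "stabilizer (code_group n) ?\<phi> (rep Q) = code_Aut n (rep Q)"
      using repE by (simp add: stabilizer_def code_Aut_def)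
    then have *: "card Q * card (code_Aut n (rep Q)) = 6 ^ n * fact n"
      using orbit_stabilizer_theorem[OF repE] by (simp add: Q_eq order_code_group)
    \<comment> \<open>Needed to divide: the product with the class size is the nonzero group
      order.\<close>
    moreover have "card (code_Aut n (rep Q)) \<noteq> 0"
      using * by (metis fact_nonzero mult_0_right mult_eq_0_iff power_not_zero zero_neq_numeral)
    ultimately show ?thesis
      by (simp add: field_simps flip: of_nat_mult)
  qed
  have "real (card E) = (\<Sum>C\<in>E. 1)" by simp
  also have "\<dots> = (\<Sum>Q\<in>E // code_equiv n. real (card Q))"
    using disjoint_sum[OF fin, of "\<lambda>_. 1 :: real"] by (simp add: quot)
  finally show ?thesis using card_Q by simp
qed

theorem theorem6:
  shows "(\<forall>n::nat. n \<ge> 1 \<longrightarrow>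
      card (self_dual_codes n) = (\<Prod>i=1..n. 2 ^ i + 1) \<and>
      (\<forall>rep. (\<forall>Q \<in> self_dual_codes n // code_equiv n. rep Q \<in> Q) \<longrightarrow>
        real (card (self_dual_codes n)) =
          (\<Sum>Q \<in> self_dual_codes n // code_equiv n.
             real (6 ^ n * fact n) / real (card (code_Aut n (rep Q))))))
    \<and> (\<forall>n::nat. n \<ge> 2 \<and> even n \<longrightarrow>
      card (even_self_dual_codes n) = (\<Prod>i=0..n-1. 2 ^ i + 1) \<and>
      (\<forall>rep. (\<forall>Q \<in> even_self_dual_codes n // code_equiv n. rep Q \<in> Q) \<longrightarrow>
        real (card (even_self_dual_codes n)) =
          (\<Sum>Q \<in> even_self_dual_codes n // code_equiv n.
             real (6 ^ n * fact n) / real (card (code_Aut n (rep Q))))))"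
proof (intro conjI allI impI)
  fix n :: nat and rep
  assume "\<forall>Q \<in> self_dual_codes n // code_equiv n. rep Q \<in> Q"
  then show "real (card (self_dual_codes n)) =
      (\<Sum>Q \<in> self_dual_codes n // code_equiv n. real (6 ^ n * fact n) / real (card (code_Aut n (rep Q))))"
    using code_act_self_dual
    by (intro mass_formula finite_self_dual_codes) (auto simp: self_dual_codes_def)
next
  fix n :: nat and rep
  assume "\<forall>Q \<in> even_self_dual_codes n // code_equiv n. rep Q \<in> Q"
  moreover have "finite (even_self_dual_codes n)"
    using finite_self_dual_codes
    by (rule finite_subset[rotated]) (auto simp: self_dual_codes_def even_self_dual_codes_def)
  ultimately show "real (card (even_self_dual_codes n)) =
      (\<Sum>Q \<in> even_self_dual_codes n // code_equiv n. real (6 ^ n * fact n) / real (card (code_Aut n (rep Q))))"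
    using code_act_even_self_dual
    by (intro mass_formula) (auto simp: even_self_dual_codes_def)
next
  fix n :: nat assume n: "n \<ge> 2 \<and> even n"
  \<comment> \<open>Index shift by one. As \<open>n\<close> is positive, \<open>n-1\<close> is a
    true predecessor; at \<open>n = 0\<close> the right side would keep the factor for
    \<open>i = 0\<close>.\<close>
  then have "(\<Prod>i=1..n. 2 ^ (i - 1) + 1) = (\<Prod>i=0..n-1. 2 ^ i + 1 :: nat)"
    by (intro prod.reindex_bij_witness[of _ Suc "\<lambda>i. i - 1"]) auto
  then show "card (even_self_dual_codes n) = (\<Prod>i=0..n-1. 2 ^ i + 1)"
    using card_even_self_dual_codes n by simp
qed (rule card_self_dual_codes)

end
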